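(* Let $n\ge 1$ and $s\ge 1$ be integers, let $Z=\{z_1,\dots,z_s\}\subset B_2^n\subset\mathbb{R}^n$ be $s$ distinct points and let $N\ge s-1$ be an integer. Then the Vandermonde matrix $V_N(Z)$ has full row rank: $$\operatorname{rank}(V_N(Z))=s.$$ In particular, the rows of $V_N(Z)$ are linearly independent.
   Context: $B_2^n=\{x\in\mathbb{R}^n:\|x\|_2\le 1\}$. $\nu=\binom{N+n}{N}$ is the number of monomials $z^\alpha=\prod_\ell z_\ell^{\alpha_\ell}$ in $n$ variables with $\alpha\in\mathbb{Z}_{\ge0}^n$, $|\alpha|=\sum_\ell\alpha_\ell\le N$. $V_N(Z)\in\mathbb{R}^{s\times\nu}$ is the matrix whose $i$-th row is $(z_i^\alpha)_{|\alpha|\le N}$ (in a fixed ordering of the multi-indices, with $0^0=1$). *)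

theory Defs
  imports "HOL-Analysis.Analysis" "Jordan_Normal_Form.DL_Rank"
begin

definition multi_indices :: "nat \<Rightarrow> ('n::finite \<Rightarrow> nat) set" where
  "multi_indices N = {\<alpha>. (\<Sum>l\<in>UNIV. \<alpha> l) \<le> N}"

text \<open>\<^const>\<open>vec_nth\<close> is the component function of \<open>real ^ 'n\<close>; its usual infix form is
  also the infix of \<^const>\<open>vec_index\<close>, hence the prefix form here.\<close>

definition monomial_at :: "real ^ 'n \<Rightarrow> ('n::finite \<Rightarrow> nat) \<Rightarrow> real" where
  "monomial_at z \<alpha> = (\<Prod>l\<in>UNIV. vec_nth z l ^ \<alpha> l)"

text \<open>The ordering of the multi-indices is the parameter \<open>\<omega>\<close>, which is meant to enumerate
  \<open>multi_indices N\<close> bijectively by the column numbers \<open>0, \<dots>, ((N + n) choose N) - 1\<close>; that the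
  number of columns is the number of multi-indices is \<open>card_multi_indices\<close> below.
  Points are numbered from \<open>0\<close>, as are the rows.\<close>

definition vandermonde_mat ::
    "(nat \<Rightarrow> ('n::finite \<Rightarrow> nat)) \<Rightarrow> nat \<Rightarrow> nat \<Rightarrow> (nat \<Rightarrow> real ^ 'n) \<Rightarrow> real mat" where
  "vandermonde_mat \<omega> N s z =
     mat s ((N + CARD('n)) choose N) (\<lambda>(i, j). monomial_at (z i) (\<omega> j))"

lemma card_multi_indices_on:
  assumes "finite A"
  shows "finite {\<alpha> :: 'a \<Rightarrow> nat. (\<forall>l. l \<notin> A \<longrightarrow> \<alpha> l = 0) \<and> sum \<alpha> A \<le> N} \<and>
    card {\<alpha> :: 'a \<Rightarrow> nat. (\<forall>l. l \<notin> A \<longrightarrow> \<alpha> l = 0) \<and> sum \<alpha> A \<le> N} = (N + card A) choose N"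
  using assms
proof (induction A arbitrary: N rule: finite_induct)
  case empty
  have "{\<alpha> :: 'a \<Rightarrow> nat. (\<forall>l. l \<notin> {} \<longrightarrow> \<alpha> l = 0) \<and> sum \<alpha> {} \<le> N} = {\<lambda>_. 0}"
    by auto
  then show ?case by simp
next
  case (insert a A)
  define S where "S B M = {\<alpha> :: 'a \<Rightarrow> nat. (\<forall>l. l \<notin> B \<longrightarrow> \<alpha> l = 0) \<and> sum \<alpha> B \<le> M}" for B M
  have IH: "finite (S A M)" "card (S A M) = (M + card A) choose M" for M
    using insert.IH[of M] unfolding S_def by auto
  have eq: "bij_betw (\<lambda>(k, f). f(a := k)) (SIGMA k:{..N}. S A (N - k)) (S (insert a A) N)"
  proof (rule bij_betw_byWitness[where f' = "\<lambda>f. (f a, f(a := 0))"])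
    have upd: "sum (f(a := k)) A = sum f A" for f :: "'a \<Rightarrow> nat" and k
      using insert.hyps by (intro sum.cong) auto
    show "\<forall>p\<in>SIGMA k:{..N}. S A (N - k).
        (\<lambda>f. (f a, f(a := 0))) ((\<lambda>(k, f). f(a := k)) p) = p"
      using insert.hyps by (auto simp: S_def fun_eq_iff)
    show "\<forall>f\<in>S (insert a A) N. (\<lambda>(k, f). f(a := k)) (f a, f(a := 0)) = f"
      by auto
    show "(\<lambda>(k, f). f(a := k)) ` (SIGMA k:{..N}. S A (N - k)) \<subseteq> S (insert a A) N"
      using insert.hyps by (auto simp: S_def upd simp del: fun_upd_apply) auto
    show "(\<lambda>f. (f a, f(a := 0))) ` S (insert a A) N \<subseteq> (SIGMA k:{..N}. S A (N - k))"
      using insert.hyps by (auto simp: S_def upd simp del: fun_upd_apply) auto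
  qed
  have "card (S (insert a A) N) = (\<Sum>k\<le>N. card (S A (N - k)))"
    using bij_betw_same_card[OF eq] IH(1) by simp
  also have "\<dots> = (\<Sum>k\<le>N. card (S A k))"
    by (rule sum.reindex_bij_witness[where i = "\<lambda>k. N - k" and j = "\<lambda>k. N - k"]) auto
  also have "\<dots> = (\<Sum>k\<le>N. (card A + k) choose k)"
    by (simp add: IH(2) add.commute)
  also have "\<dots> = (N + card (insert a A)) choose N"
    using insert.hyps sum_choose_lower[of "card A" N] by (simp add: ac_simps)
  finally have "card (S (insert a A) N) = (N + card (insert a A)) choose N" .
  moreover have "finite (S (insert a A) N)"
    using bij_betw_finite[OF eq] IH(1) by simp
  ultimately show ?case unfolding S_def by blast
qed

lemma finite_multi_indices: "finite (multi_indices N :: ('n::finite \<Rightarrow> nat) set)"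
  and card_multi_indices:
    "card (multi_indices N :: ('n::finite \<Rightarrow> nat) set) = (N + CARD('n)) choose N"
  using card_multi_indices_on[of "UNIV :: 'n set" N] by (simp_all add: multi_indices_def)

end

theory Submission
  imports Defs
begin

text \<open>The product over \<open>j \<noteq> i\<close> of the affine functions
  \<open>x \<mapsto> \<langle>x - z\<^sub>j, z\<^sub>i - z\<^sub>j\<rangle> / \<parallel>z\<^sub>i - z\<^sub>j\<parallel>\<^sup>2\<close>
  is a polynomial of degree at most \<open>s - 1\<close> that is \<open>1\<close> at \<open>z\<^sub>i\<close> and \<open>0\<close> at the other points.
  The coefficient vectors of these \<open>s\<close> polynomials are the columns of a right inverse of the
  Vandermonde matrix.\<close>

definition poly_fun :: "nat \<Rightarrow> (real ^ 'n::finite \<Rightarrow> real) \<Rightarrow> bool" where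
  "poly_fun k f \<longleftrightarrow> (\<exists>c. \<forall>x. f x = (\<Sum>\<alpha>\<in>multi_indices k. c \<alpha> * monomial_at x \<alpha>))"

lemma poly_fun_monomial:
  fixes \<alpha> :: "'n::finite \<Rightarrow> nat"
  assumes "\<alpha> \<in> multi_indices k"
  shows "poly_fun k (\<lambda>x. monomial_at x \<alpha>)"
  unfolding poly_fun_def
proof (intro exI allI)
  fix x :: "real ^ 'n"
  show "monomial_at x \<alpha> =
      (\<Sum>\<beta>\<in>multi_indices k. (if \<beta> = \<alpha> then 1 else 0) * monomial_at x \<beta>)"
    using assms by (simp add: finite_multi_indices if_distrib[of "\<lambda>a. a * _"] cong: if_cong)
qed

lemma poly_fun_scale:
  assumes "poly_fun k f"
  shows "poly_fun k (\<lambda>x. a * f x)"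
proof -
  obtain c where "\<forall>x. f x = (\<Sum>\<alpha>\<in>multi_indices k. c \<alpha> * monomial_at x \<alpha>)"
    using assms unfolding poly_fun_def by blast
  then show ?thesis unfolding poly_fun_def
    by (intro exI[of _ "\<lambda>\<alpha>. a * c \<alpha>"]) (simp add: sum_distrib_left mult.assoc)
qed

lemma poly_fun_add:
  assumes "poly_fun k f" "poly_fun k g"
  shows "poly_fun k (\<lambda>x. f x + g x)"
proof -
  obtain c d where "\<forall>x. f x = (\<Sum>\<alpha>\<in>multi_indices k. c \<alpha> * monomial_at x \<alpha>)"
      "\<forall>x. g x = (\<Sum>\<alpha>\<in>multi_indices k. d \<alpha> * monomial_at x \<alpha>)"
    using assms unfolding poly_fun_def by blast
  then show ?thesis unfolding poly_fun_def
    by (intro exI[of _ "\<lambda>\<alpha>. c \<alpha> + d \<alpha>"]) (simp add: sum.distrib distrib_right)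
qed

lemma poly_fun_sum:
  assumes "finite I" "\<And>i. i \<in> I \<Longrightarrow> poly_fun k (f i)"
  shows "poly_fun k (\<lambda>x. \<Sum>i\<in>I. f i x)"
  using assms
proof (induction I rule: finite_induct)
  case empty
  show ?case unfolding poly_fun_def by (intro exI[of _ "\<lambda>_. 0"]) simp
next
  case (insert i I)
  then show ?case by (simp add: poly_fun_add)
qed

lemma poly_fun_const: "poly_fun k (\<lambda>x :: real ^ 'n::finite. a)"
  using poly_fun_scale[OF poly_fun_monomial[of "\<lambda>_ :: 'n. 0" k], of a]
  by (simp add: multi_indices_def monomial_at_def)

text \<open>Each monomial of degree at most \<open>k\<close> is itself a \<open>poly_fun m\<close>,
  so closure under linear combinations suffices and no coefficients have to be padded with
  zeros.\<close>

lemma poly_fun_mono: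
  assumes "poly_fun k f" "k \<le> m"
  shows "poly_fun m f"
proof -
  obtain c where c: "f = (\<lambda>x. \<Sum>\<alpha>\<in>multi_indices k. c \<alpha> * monomial_at x \<alpha>)"
    using assms unfolding poly_fun_def by blast
  show ?thesis unfolding c
    by (intro poly_fun_sum poly_fun_scale poly_fun_monomial finite_multi_indices)
       (use assms(2) in \<open>auto simp: multi_indices_def\<close>)
qed

lemma monomial_at_increment:
  "monomial_at x (\<alpha>(l := Suc (\<alpha> l))) = vec_nth x l * monomial_at x \<alpha>"
proof -
  have "monomial_at x (\<alpha>(l := Suc (\<alpha> l))) =
      vec_nth x l ^ Suc (\<alpha> l) * (\<Prod>i\<in>UNIV - {l}. vec_nth x i ^ (\<alpha>(l := Suc (\<alpha> l))) i)"
    unfolding monomial_at_def by (subst prod.remove[of UNIV l]) auto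
  also have "(\<Prod>i\<in>UNIV - {l}. vec_nth x i ^ (\<alpha>(l := Suc (\<alpha> l))) i) =
      (\<Prod>i\<in>UNIV - {l}. vec_nth x i ^ \<alpha> i)"
    by (intro prod.cong) auto
  finally show ?thesis
    unfolding monomial_at_def by (subst (2) prod.remove[of UNIV l]) (auto simp: mult.assoc)
qed

lemma multi_indices_increment:
  assumes "\<alpha> \<in> multi_indices k"
  shows "\<alpha>(l := Suc (\<alpha> l)) \<in> multi_indices (Suc k)"
proof -
  have "sum (\<alpha>(l := Suc (\<alpha> l))) (UNIV - {l}) = sum \<alpha> (UNIV - {l})"
    by (intro sum.cong) auto
  then show ?thesis
    using assms sum.remove[of UNIV l \<alpha>] sum.remove[of UNIV l "\<alpha>(l := Suc (\<alpha> l))"]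
    \<comment> \<open>\<open>fun_upd_apply\<close> is held back at first, so that the sum off
      \<open>l\<close> keeps the form of the equation above; the second \<open>simp\<close>
      evaluates the update at \<open>l\<close>.\<close>
    by (simp add: multi_indices_def del: fun_upd_apply) simp
qed

text \<open>The coefficients stay and every monomial gains one in its exponent at \<open>l\<close>.
  The sum still runs over \<open>multi_indices k\<close>; only the degree of its terms has to be
  bounded.\<close>

lemma poly_fun_mult_coordinate:
  assumes "poly_fun k f"
  shows "poly_fun (Suc k) (\<lambda>x. vec_nth x l * f x)"
proof -
  obtain c where c: "\<forall>x. f x = (\<Sum>\<alpha>\<in>multi_indices k. c \<alpha> * monomial_at x \<alpha>)"
    using assms unfolding poly_fun_def by blast
  have "(\<lambda>x. vec_nth x l * f x) =
      (\<lambda>x. \<Sum>\<alpha>\<in>multi_indices k. c \<alpha> * monomial_at x (\<alpha>(l := Suc (\<alpha> l))))"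
    using c by (simp add: fun_eq_iff monomial_at_increment sum_distrib_left mult.left_commute)
  then show ?thesis
    by (simp only:) (intro poly_fun_sum poly_fun_scale poly_fun_monomial
        multi_indices_increment finite_multi_indices)
qed

lemma poly_fun_mult_affine:
  fixes u :: "real ^ 'n::finite"
  assumes "poly_fun k f"
  shows "poly_fun (Suc k) (\<lambda>x. ((x - v) \<bullet> u) * f x)"
proof -
  \<comment> \<open>In coordinates, the linear part consists of multiples of products treated above,
    while the constant part is a multiple of \<open>f\<close>, whose degree bound is raised by
    \<open>poly_fun_mono\<close>.\<close>
  have eq: "(\<lambda>x. ((x - v) \<bullet> u) * f x) =
      (\<lambda>x. (\<Sum>l\<in>UNIV. vec_nth u l * (vec_nth x l * f x)) + (- (v \<bullet> u)) * f x)"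
    by (simp add: fun_eq_iff inner_diff_left inner_vec_def sum_distrib_right
        sum_distrib_left sum_subtractf algebra_simps)
  show ?thesis
    unfolding eq
    by (intro poly_fun_add poly_fun_sum poly_fun_scale poly_fun_mult_coordinate
        poly_fun_mono[OF assms]) (auto intro: assms)
qed

lemma poly_fun_prod_affine:
  fixes v u :: "'i \<Rightarrow> real ^ 'n::finite"
  assumes "finite J"
  shows "poly_fun (card J) (\<lambda>x. \<Prod>j\<in>J. (x - v j) \<bullet> u j)"
  using assms
proof (induction J rule: finite_induct)
  case empty
  show ?case by (simp add: poly_fun_const)
next
  case (insert i I)
  then show ?case by (simp add: poly_fun_mult_affine)
qed

lemma poly_fun_interpolation:
  fixes z :: "'i \<Rightarrow> real ^ 'n::finite"
  assumes "finite I" "inj_on z I" "card I - 1 \<le> N" "i \<in> I"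
  shows "\<exists>f. poly_fun N f \<and> (\<forall>j\<in>I. f (z j) = (if j = i then 1 else 0))"
proof -
  \<comment> \<open>The factor for \<open>j\<close> vanishes at \<open>z j\<close> and equals the
    squared norm of \<open>z i - z j\<close> at \<open>z i\<close>, which is nonzero by injectivity.
    All normalizing denominators are collected in \<open>p (z i)\<close>.\<close>
  define p where "p x = (\<Prod>j\<in>I - {i}. (x - z j) \<bullet> (z i - z j))" for x
  have "poly_fun N p"
    unfolding p_def using poly_fun_prod_affine[of "I - {i}" z "\<lambda>j. z i - z j"] assms
    by (auto intro: poly_fun_mono)
  then have "poly_fun N (\<lambda>x. inverse (p (z i)) * p x)"
    by (rule poly_fun_scale)
  moreover have "p (z i) \<noteq> 0"
    using assms by (auto simp: p_def inj_on_def)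
  moreover have "p (z j) = 0" if "j \<in> I" "j \<noteq> i" for j
    using assms that by (auto simp: p_def intro!: bexI[of _ j])
  ultimately show ?thesis
    by (intro exI[of _ "\<lambda>x. inverse (p (z i)) * p x"]) auto
qed

context
  fixes A B :: "'a::field mat" and m k :: nat
  assumes A: "A \<in> carrier_mat m k" and B: "B \<in> carrier_mat k m" and AB: "A * B = 1\<^sub>m m"
begin

text \<open>Every \<open>y\<close> is \<open>A\<close> applied to \<open>B *\<^sub>v y\<close>, so
  the columns of \<open>A\<close> span the whole space.\<close>

lemma rank_right_invertible: "vec_space.rank m A = m"
proof -
  interpret vec_space "TYPE('a)" m .
  have "\<exists>x\<in>carrier_vec k. A *\<^sub>v x = y" if y: "y \<in> carrier_vec m" for y
  proof (rule bexI[of _ "B *\<^sub>v y"])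
    have "A *\<^sub>v (B *\<^sub>v y) = (A * B) *\<^sub>v y"
      using A B y by (simp add: assoc_mult_mat_vec)
    then show "A *\<^sub>v (B *\<^sub>v y) = y"
      using AB y by simp
    show "B *\<^sub>v y \<in> carrier_vec k"
      using B y by simp
  qed
  then have "col_space A = carrier_vec m"
    using A by (auto simp: col_space_eq)
  then have "span (set (cols A)) = carrier V"
    by (simp add: col_space_def)
  then show ?thesis
    \<comment> \<open>With \<open>carrier V\<close> kept folded, the span of the columns, taken as a
      space of its own, collapses to \<open>V\<close>.\<close>
    unfolding rank_def using dim_is_n by (simp del: cV)
qed

text \<open>Equal rows of \<open>A\<close> would give equal rows of the identity
  \<open>A * B\<close>. Since \<open>set (rows A)\<close> forgets repetitions, this is what turns
  independence of the set into independence of the family of rows.\<close>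

lemma distinct_rows_right_invertible: "distinct (rows A)"
  unfolding distinct_conv_nth
proof (intro allI impI notI)
  fix i j assume ij: "i < length (rows A)" "j < length (rows A)" "i \<noteq> j" "rows A ! i = rows A ! j"
  then have less: "i < m" "j < m" and eq: "row A i = row A j"
    using A by auto
  have "(A * B) $$ (i, i) = (A * B) $$ (j, i)"
    using A B less eq by simp
  then show False
    using AB less \<open>i \<noteq> j\<close> by simp
qed

text \<open>A dependency among the rows is a nonzero vector in the kernel of
  \<open>A\<^sup>T\<close>, but \<open>B\<^sup>T\<close> is a left inverse of
  \<open>A\<^sup>T\<close>.\<close>

lemma lin_indpt_rows_right_invertible:
  "module.lin_indpt class_ring (module_vec TYPE('a) k) (set (rows A))"
proof
  interpret vec_space "TYPE('a)" k .
  have At: "A\<^sup>T \<in> carrier_mat k m" using A by simp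
  assume "lin_dep (set (rows A))"
  then obtain v where v: "v \<in> carrier_vec m" "v \<noteq> 0\<^sub>v m" "A\<^sup>T *\<^sub>v v = 0\<^sub>v k"
    using lin_depE[OF At] distinct_rows_right_invertible by auto
  have "B\<^sup>T * A\<^sup>T = 1\<^sub>m m"
    using AB transpose_mult[OF A B] by simp
  moreover have "(B\<^sup>T * A\<^sup>T) *\<^sub>v v = B\<^sup>T *\<^sub>v (A\<^sup>T *\<^sub>v v)"
    using A B v(1) by (intro assoc_mult_mat_vec) auto
  ultimately have "v = B\<^sup>T *\<^sub>v 0\<^sub>v k"
    using v by simp
  then show False
    using v(2) B by auto
qed

end

theorem lemma2p6:
  fixes z :: "nat \<Rightarrow> real ^ 'n"
    and \<omega> :: "nat \<Rightarrow> ('n \<Rightarrow> nat)"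
    and s N :: nat
  assumes "s \<ge> 1"
    and "z ` {..<s} \<subseteq> cball 0 1"
    and "inj_on z {..<s}"
    and "N \<ge> s - 1"
    and "bij_betw \<omega> {..<(N + CARD('n)) choose N} (multi_indices N)"
  shows "vec_space.rank s (vandermonde_mat \<omega> N s z) = s
    \<and> distinct (rows (vandermonde_mat \<omega> N s z))
    \<and> module.lin_indpt class_ring (module_vec TYPE(real) ((N + CARD('n)) choose N))
        (set (rows (vandermonde_mat \<omega> N s z)))"
proof -
  define \<nu> where "\<nu> = (N + CARD('n)) choose N"
  have "\<exists>c. \<forall>j<s. (\<Sum>\<alpha>\<in>multi_indices N. c \<alpha> * monomial_at (z j) \<alpha>) = (if j = i then 1 else 0)"
    if "i < s" for i
  proof -
    have "\<exists>f. poly_fun N f \<and> (\<forall>j\<in>{..<s}. f (z j) = (if j = i then 1 else 0))"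
      using assms that by (intro poly_fun_interpolation) auto
    then show ?thesis
      unfolding poly_fun_def by (metis lessThan_iff)
  qed
  then obtain c where c: "\<And>i j. i < s \<Longrightarrow> j < s \<Longrightarrow>
      (\<Sum>\<alpha>\<in>multi_indices N. c i \<alpha> * monomial_at (z j) \<alpha>) = (if j = i then 1 else 0)"
    by metis
  \<comment> \<open>Column \<open>i\<close> lists the coefficients of the interpolation function of
    \<open>z i\<close> in the order \<open>\<omega>\<close>, so entry \<open>(j, i)\<close> of the
    product with the Vandermonde matrix is the value of that function at \<open>z j\<close>.\<close>
  define C where "C = mat \<nu> s (\<lambda>(j, i). c i (\<omega> j))"
  have V: "vandermonde_mat \<omega> N s z \<in> carrier_mat s \<nu>"
    by (simp add: vandermonde_mat_def \<nu>_def)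
  have C: "C \<in> carrier_mat \<nu> s"
    by (simp add: C_def)
  have "vandermonde_mat \<omega> N s z * C = 1\<^sub>m s"
  proof (rule eq_matI)
    fix j i assume "j < dim_row (1\<^sub>m s :: real mat)" "i < dim_col (1\<^sub>m s :: real mat)"
    then have ji: "j < s" "i < s" by auto
    have "(vandermonde_mat \<omega> N s z * C) $$ (j, i) =
        (\<Sum>l<\<nu>. c i (\<omega> l) * monomial_at (z j) (\<omega> l))"
      using ji by (simp add: vandermonde_mat_def C_def \<nu>_def scalar_prod_def
          atLeast0LessThan mult.commute)
    also have "\<dots> = (\<Sum>\<alpha>\<in>multi_indices N. c i \<alpha> * monomial_at (z j) \<alpha>)"
      using assms(5) by (intro sum.reindex_bij_betw) (simp add: \<nu>_def)
    finally show "(vandermonde_mat \<omega> N s z * C) $$ (j, i) = 1\<^sub>m s $$ (j, i)"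
      using c ji by simp
  qed (use V C in auto)
  note VC = V C this
  show ?thesis
    using rank_right_invertible[OF VC] distinct_rows_right_invertible[OF VC]
      lin_indpt_rows_right_invertible[OF VC]
    by (simp add: \<nu>_def)
qed

end
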